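(* Let $\varphi:\mathbb R\to\mathbb R$ and $q:\mathbb R\to\mathbb R$ be continuous functions with $\varphi(x)\ge 0$ and $q(x)\ge 1$ for all $x\in\mathbb R$. Suppose that: 1) there is a constant $a\ge 1$ such that for all $x\in\mathbb R$ $$a^{-1}q(x)\le q(t)\le a\,q(x)\qquad\text{for all } t\in[x-1,x+1];$$ 2) $\displaystyle \sigma\le \frac{1}{6\sqrt a}$, where $\sigma=\sup_{x\in\mathbb R}\big(\varphi(x)q(x)\big)$. Consider the equation $$-y''(x)+q(x)\,y(x-\varphi(x))=f(x),\qquad x\in\mathbb R. \qquad ( * )$$ Then $( * )$ is correctly solvable in $C(\mathbb R)$, that is: I) for every $f\in C(\mathbb R)$ equation $( * )$ has a unique solution $y\in C(\mathbb R)$; II) there is a constant $c\in(0,\infty)$ such that for every $f\in C(\mathbb R)$ the solution $y\in C(\mathbb R)$ of $( * )$ satisfies $\|y\|_{C(\mathbb R)}\le c\|f\|_{C(\mathbb R)}$. In addition, $( * )$ is separable in $C(\mathbb R)$, that is, there is a constant $c\in(0,\infty)$ such that for every $f\in C(\mathbb R)$ the solution $y\in C(\mathbb R)$ of $( * )$ satisfies $$\|y''(x)\|_{C(\mathbb R)}+\|q(x)y(x-\varphi(x))\|_{C(\mathbb R)}\le c\|f(x)\|_{C(\mathbb R)}.$$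
   Context: $C(\mathbb R)$ is the space of bounded continuous functions on $\mathbb R$ with the norm $\|f\|_{C(\mathbb R)}=\sup_{x\in\mathbb R}|f(x)|$. A solution of $( * )$ is any twice continuously differentiable function $y$ on $\mathbb R$ satisfying $( * )$ for all $x\in\mathbb R$. *)

theory Defs
  imports "HOL-Analysis.Analysis"
begin

text \<open>
  The Banach space \<open>C(\<real>)\<close> is the library type \<^typ>\<open>real \<Rightarrow>\<^sub>C real\<close> of bounded continuous functions.
\<close>

lemma norm_bcontfun_eq_Sup_abs:
  fixes f :: "real \<Rightarrow>\<^sub>C real"
  shows "norm f = (SUP x. \<bar>apply_bcontfun f x\<bar>)"
  by (simp add: norm_bcontfun_def dist_bcontfun_def zero_bcontfun.rep_eq dist_real_def)

definition twice_continuously_differentiable :: "(real \<Rightarrow> real) \<Rightarrow> bool" where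
  "twice_continuously_differentiable y \<longleftrightarrow>
     (\<forall>x. y differentiable (at x)) \<and>
     (\<forall>x. deriv y differentiable (at x)) \<and>
     continuous_on UNIV (deriv (deriv y))"

definition is_solution ::
  "(real \<Rightarrow> real) \<Rightarrow> (real \<Rightarrow> real) \<Rightarrow> (real \<Rightarrow> real) \<Rightarrow> (real \<Rightarrow> real) \<Rightarrow> bool" where
  "is_solution \<phi> q f y \<longleftrightarrow>
     twice_continuously_differentiable y \<and>
     (\<forall>x. - deriv (deriv y) x + q x * y (x - \<phi> x) = f x)"

definition correctly_solvable :: "(real \<Rightarrow> real) \<Rightarrow> (real \<Rightarrow> real) \<Rightarrow> bool" where
  "correctly_solvable \<phi> q \<longleftrightarrow>
     (\<forall>f :: real \<Rightarrow>\<^sub>C real. \<exists>!y :: real \<Rightarrow>\<^sub>C real.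
        is_solution \<phi> q (apply_bcontfun f) (apply_bcontfun y)) \<and>
     (\<exists>c>0. \<forall>(f :: real \<Rightarrow>\<^sub>C real) (y :: real \<Rightarrow>\<^sub>C real).
        is_solution \<phi> q (apply_bcontfun f) (apply_bcontfun y) \<longrightarrow> norm y \<le> c * norm f)"

text \<open>
  The two membership conditions state that both norms are finite; without them
  \<^const>\<open>Bcontfun\<close> would be applied to functions on which its value is unspecified.
\<close>

definition separable_in_C :: "(real \<Rightarrow> real) \<Rightarrow> (real \<Rightarrow> real) \<Rightarrow> bool" where
  "separable_in_C \<phi> q \<longleftrightarrow>
     (\<exists>c>0. \<forall>(f :: real \<Rightarrow>\<^sub>C real) (y :: real \<Rightarrow>\<^sub>C real).
        is_solution \<phi> q (apply_bcontfun f) (apply_bcontfun y) \<longrightarrow>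
          deriv (deriv (apply_bcontfun y)) \<in> bcontfun \<and>
          (\<lambda>x. q x * apply_bcontfun y (x - \<phi> x)) \<in> bcontfun \<and>
          norm (Bcontfun (deriv (deriv (apply_bcontfun y)))) +
          norm (Bcontfun (\<lambda>x. q x * apply_bcontfun y (x - \<phi> x))) \<le> c * norm f)"

end

theory Submission
  imports Defs
begin

text \<open>
  Everything rests on a maximum principle for the delay equation. Let \<open>\<bar>y\<bar> \<le> Y\<close> and
  \<open>\<bar>f\<bar> \<le> F\<close> near a point \<open>c\<close>, and let \<open>x\<close> be a point where \<open>y\<close> minus a quadratic barrier
  of width \<open>r\<close> centred at \<open>c\<close> is maximal. There \<open>\<bar>y'\<bar> \<le> 4 * Y / r\<close> and \<open>y'' \<le> 4 * Y / r\<^sup>2\<close>.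
  By Taylor expansion \<open>y (x - \<phi> x)\<close> differs from \<open>y x\<close> by about \<open>\<phi> x * \<bar>y' x\<bar>\<close> and
  \<open>(\<phi> x)\<^sup>2 * sup \<bar>y''\<bar>\<close>, where the equation itself gives \<open>\<bar>y''\<bar> \<le> a * q x * Y + F\<close> on the
  delay interval. After multiplication by \<open>q x\<close> the second error is at most
  \<open>a * (\<phi> x * q x)\<^sup>2 * Y \<le> Y / 36\<close> up to a multiple of \<open>F\<close>; hence \<open>q x * y x\<close> is bounded by
  a multiple of \<open>Y\<close>, with a factor that decreases to \<open>1 / 36\<close> as \<open>r\<close> grows, plus a multiple of
  \<open>F\<close> (\<open>maximum_principle_local\<close>).

  With a barrier of width \<open>6\<close> this reads \<open>\<bar>y c\<bar> \<le> Y / 2 + 2 * F\<close>, so every bounded solution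
  satisfies \<open>norm y \<le> 4 * norm f\<close>; applied to differences, this gives uniqueness. With a
  barrier of width \<open>1\<close>, on which \<open>q\<close> exceeds its value at \<open>c\<close> at most by the factor \<open>a\<close> and vice
  versa, it bounds \<open>q * \<bar>y\<bar>\<close> by a multiple of \<open>norm f\<close>, and this is separability.

  For existence, suppose first that \<open>q\<close> is bounded. The a priori bound holds along the family
  \<open>- y'' + (1 - \<theta>) * y + \<theta> * q * y (x - \<phi> x) = f\<close> uniformly in \<open>\<theta> \<in> {0..1}\<close>, and the
  lower order terms are bounded operators, so Banach's fixed point theorem carries solvability
  from \<open>\<theta> = 0\<close> to \<open>\<theta> = 1\<close> in finitely many steps (\<open>homotopy_step\<close>). A general \<open>q\<close> is
  approximated by freezing the coefficients outside \<open>{- n..n}\<close>. The difference of two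
  approximate solutions solves the homogeneous equation on a large interval, and iterating the
  local estimate with \<open>F = 0\<close> shows that it decays geometrically away from the ends
  (\<open>homogeneous_solution_decay\<close>). So the approximations converge locally uniformly, together
  with their second derivatives, to a bounded solution.
\<close>

section \<open>Maximum points and antiderivatives\<close>

lemma second_derivative_nonpos_at_local_max:
  fixes g g' :: "real \<Rightarrow> real"
  assumes g: "\<And>z. (g has_real_derivative g' z) (at z)"
    and g': "(g' has_real_derivative l) (at x)"
    and d: "d > 0" and max: "\<And>z. \<bar>x - z\<bar> < d \<Longrightarrow> g z \<le> g x"
  shows "g' x = 0" and "l \<le> 0"
proof -
  show zero: "g' x = 0"
    using DERIV_local_max[OF g d] max by blast
  show "l \<le> 0"
  proof (rule ccontr)
    assume "\<not> l \<le> 0"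
    then obtain e where e: "e > 0" "\<And>h. 0 < h \<Longrightarrow> h < e \<Longrightarrow> g' x < g' (x + h)"
      using DERIV_pos_inc_right[OF g'] by force
    define h where "h = min d e / 2"
    have h: "0 < h" "h < d" "h < e"
      using d e(1) by (auto simp: h_def)
    obtain z where z: "x < z" "z < x + h" "g (x + h) - g x = (x + h - x) * g' z"
      using MVT2[of x "x + h" g g'] h(1) g by auto
    have "g' z > 0"
      using e(2)[of "z - x"] z h zero by auto
    then have "g (x + h) > g x"
      using z(3) h(1) by (simp add: zero_less_mult_iff algebra_simps)
    then show False
      using max[of "x + h"] h by auto
  qed
qed

text \<open>
  The quadratic barrier \<open>2 Y ((x - c) / r)\<^sup>2\<close> vanishes at the centre and equals \<open>2 Y\<close> at the
  end points, so subtracting it from \<open>y\<close> moves the maximum into the interior. There the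
  derivatives of \<open>y\<close> are controlled by those of the barrier.
\<close>

lemma barrier_maximum_point:
  fixes y y' y'' :: "real \<Rightarrow> real"
  assumes y: "\<And>x. (y has_real_derivative y' x) (at x)"
    and y': "\<And>x. (y' has_real_derivative y'' x) (at x)"
    and r: "r > 0" and bound: "\<And>x. x \<in> {c - r..c + r} \<Longrightarrow> \<bar>y x\<bar> \<le> Y"
  obtains x where "x \<in> {c - r..c + r}" "y c \<le> y x" "\<bar>y' x\<bar> \<le> 4 * Y / r" "y'' x \<le> 4 * Y / r\<^sup>2"
proof -
  define k where "k = 2 * Y / r\<^sup>2"
  define g where "g = (\<lambda>x. y x - k * (x - c)\<^sup>2)"
  define g' where "g' = (\<lambda>x. y' x - 2 * k * (x - c))"
  have Y: "Y \<ge> 0"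
    using bound[of c] r by auto
  then have k: "k \<ge> 0"
    by (simp add: k_def)
  have kr: "k * r\<^sup>2 = 2 * Y"
    using r by (simp add: k_def)
  have g: "(g has_real_derivative g' x) (at x)" for x
    unfolding g_def g'_def by (auto intro!: derivative_eq_intros y)
  have g': "(g' has_real_derivative y'' x - 2 * k) (at x)" for x
    unfolding g'_def by (auto intro!: derivative_eq_intros y')
  have "continuous_on {c - r..c + r} g"
    using g by (meson DERIV_atLeastAtMost_imp_continuous_on)
  then obtain x0 where x0: "x0 \<in> {c - r..c + r}" "\<And>z. z \<in> {c - r..c + r} \<Longrightarrow> g z \<le> g x0"
    using continuous_attains_sup[of "{c - r..c + r}" g] r by auto
  obtain x where x: "x \<in> {c - r<..<c + r}" "\<And>z. z \<in> {c - r..c + r} \<Longrightarrow> g z \<le> g x"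
  proof (cases "x0 \<in> {c - r<..<c + r}")
    case True
    then show ?thesis
      using x0 that by blast
  next
    case False
    then have "(x0 - c)\<^sup>2 = r\<^sup>2"
      using x0(1) by (auto simp: power2_eq_square)
    then have "g x0 = y x0 - 2 * Y"
      using kr by (simp add: g_def)
    also have "\<dots> \<le> y c"
      using bound[of x0] bound[of c] x0(1) r by auto
    also have "\<dots> = g c"
      by (simp add: g_def)
    finally have "g x0 \<le> g c" .
    then show ?thesis
      using x0(2) r by (intro that[of c]) fastforce+
  qed
  have "g z \<le> g x" if "\<bar>x - z\<bar> < min (x - (c - r)) (c + r - x)" for z
    using that by (intro x(2)) auto
  then have zero: "g' x = 0" and nonpos: "y'' x - 2 * k \<le> 0"
    using second_derivative_nonpos_at_local_max[OF g g', of "min (x - (c - r)) (c + r - x)" x] x(1)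
    by auto
  have "\<bar>y' x\<bar> = 2 * k * \<bar>x - c\<bar>"
    using zero k by (simp add: g'_def abs_mult)
  also have "\<dots> \<le> 2 * k * r"
    using x(1) k by (intro mult_left_mono) auto
  also have "\<dots> = 4 * Y / r"
    using r by (simp add: k_def power2_eq_square field_simps)
  finally have deriv: "\<bar>y' x\<bar> \<le> 4 * Y / r" .
  have "y c = g c"
    by (simp add: g_def)
  also have "\<dots> \<le> g x"
    using r by (intro x(2)) auto
  also have "\<dots> \<le> y x"
    using k by (simp add: g_def)
  finally have "y c \<le> y x" .
  moreover have "y'' x \<le> 4 * Y / r\<^sup>2"
    using nonpos by (simp add: k_def)
  ultimately show thesis
    using that[of x] x(1) deriv by auto
qed

lemma antiderivative_exists:
  fixes h :: "real \<Rightarrow> real"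
  assumes "continuous_on UNIV h"
  obtains H where "\<And>x. (H has_real_derivative h x) (at x)"
proof -
  have "\<exists>F. \<forall>x::real. -\<infinity> < ereal x \<longrightarrow> ereal x < \<infinity> \<longrightarrow> (F has_vector_derivative h x) (at x)"
    by (intro einterval_antiderivative) (use assms in \<open>auto simp: continuous_on_eq_continuous_at\<close>)
  then show thesis
    using that by (auto simp: has_real_derivative_iff_has_vector_derivative)
qed

text \<open>
  Subtracting a second antiderivative of the limit of \<open>u n''\<close> reduces the claim to second
  derivatives tending to zero; there each \<open>u n\<close> deviates from its chord through \<open>0\<close> and \<open>1\<close>
  by at most a multiple of the second derivative, so that the limit is affine.
\<close>

lemma second_derivative_of_limit:
  fixes u u' u'' :: "nat \<Rightarrow> real \<Rightarrow> real"
  assumes u: "\<And>n x. (u n has_real_derivative u' n x) (at x)"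
    and u': "\<And>n x. (u' n has_real_derivative u'' n x) (at x)"
    and lim: "\<And>x. (\<lambda>n. u n x) \<longlonglongrightarrow> v x"
    and lim'': "\<And>R. uniform_limit {-R..R} u'' g sequentially"
    and g: "continuous_on UNIV g"
  obtains v' where "\<And>x. (v has_real_derivative v' x) (at x)"
    and "\<And>x. (v' has_real_derivative g x) (at x)"
proof -
  obtain G' where G': "\<And>x. (G' has_real_derivative g x) (at x)"
    using antiderivative_exists[OF g] by blast
  then have "continuous_on UNIV G'"
    by (meson DERIV_continuous continuous_at_imp_continuous_on)
  then obtain G where G: "\<And>x. (G has_real_derivative G' x) (at x)"
    using antiderivative_exists by blast
  have affine: "v x - G x = (v 0 - G 0) + x * ((v 1 - G 1) - (v 0 - G 0))" for x
  proof -
    define w where "w = (\<lambda>n x. u n x - G x)"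
    define w' where "w' = (\<lambda>n x. u' n x - G' x)"
    have w: "(w n has_real_derivative w' n x) (at x)" for n x
      unfolding w_def w'_def by (intro DERIV_diff u G)
    have w': "(w' n has_real_derivative u'' n x - g x) (at x)" for n x
      unfolding w'_def by (intro DERIV_diff u' G')
    define R where "R = \<bar>x\<bar> + 1"
    have in_R: "0 \<in> {-R..R}" "1 \<in> {-R..R}" "x \<in> {-R..R}"
      by (auto simp: R_def)
    have mvt: "\<exists>t\<in>{-R..R}. f s - f 0 = s * f' t"
      if f: "\<And>z. (f has_real_derivative f' z) (at z)" and s: "s \<in> {-R..R}"
      for f f' :: "real \<Rightarrow> real" and s
    proof -
      consider "s = 0" | "0 < s" | "s < 0"
        by linarith
      then show ?thesis
      proof cases
        case 1
        then show ?thesis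
          using s by auto
      next
        case 2
        then obtain t where "0 < t" "t < s" "f s - f 0 = (s - 0) * f' t"
          using MVT2[of 0 s f f'] f by blast
        then show ?thesis
          using s by (intro bexI[of _ t]) auto
      next
        case 3
        then obtain t where "s < t" "t < 0" "f 0 - f s = (0 - s) * f' t"
          using MVT2[of s 0 f f'] f by blast
        then show ?thesis
          using s by (intro bexI[of _ t]) auto
      qed
    qed
    define dev where "dev = (\<lambda>n. (w n x - w n 0) - x * (w n 1 - w n 0))"
    have "dev \<longlonglongrightarrow> 0"
    proof (rule LIMSEQ_I)
      fix e :: real
      assume e: "e > 0"
      define d where "d = e / (4 * R\<^sup>2)"
      have R: "R > 0"
        by (simp add: R_def)
      have d: "d > 0"
        using e R by (simp add: d_def)
      have "\<forall>\<^sub>F n in sequentially. \<forall>t\<in>{-R..R}. dist (u'' n t) (g t) < d"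
        using lim''[of R] d by (auto simp: uniform_limit_iff)
      then obtain N where "\<forall>n\<ge>N. \<forall>t\<in>{-R..R}. \<bar>u'' n t - g t\<bar> < d"
        by (auto simp only: eventually_sequentially dist_real_def)
      then have N: "\<bar>u'' n t - g t\<bar> < d" if "n \<ge> N" "t \<in> {-R..R}" for n t
        using that by blast
      have "norm (dev n - 0) < e" if n: "n \<ge> N" for n
      proof -
        obtain t where t: "t \<in> {-R..R}" "w n x - w n 0 = x * w' n t"
          using mvt[OF w in_R(3)] by blast
        obtain s where s: "s \<in> {-R..R}" "w n 1 - w n 0 = 1 * w' n s"
          using mvt[OF w in_R(2)] by blast
        have near: "\<bar>w' n z - w' n 0\<bar> \<le> R * d" if z: "z \<in> {-R..R}" for z
        proof -
          obtain b where b: "b \<in> {-R..R}" "w' n z - w' n 0 = z * (u'' n b - g b)"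
            using mvt[OF w' z] by blast
          then show ?thesis
            using z less_imp_le[OF N[OF n b(1)]] R by (auto simp: abs_mult intro!: mult_mono)
        qed
        have "dev n = x * (w' n t - w' n s)"
          using t(2) s(2) by (simp add: dev_def algebra_simps)
        also have "\<bar>\<dots>\<bar> \<le> R * (2 * (R * d))"
          unfolding abs_mult
          using near[OF t(1)] near[OF s(1)] R by (intro mult_mono) (auto simp: R_def)
        also have "\<dots> < e"
          using R e by (simp add: d_def power2_eq_square)
        finally show ?thesis
          by simp
      qed
      then show "\<exists>N. \<forall>n\<ge>N. norm (dev n - 0) < e"
        by blast
    qed
    moreover have "dev \<longlonglongrightarrow> ((v x - G x) - (v 0 - G 0)) - x * ((v 1 - G 1) - (v 0 - G 0))"
      unfolding dev_def w_def by (intro tendsto_intros lim)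
    ultimately have "0 = ((v x - G x) - (v 0 - G 0)) - x * ((v 1 - G 1) - (v 0 - G 0))"
      by (rule LIMSEQ_unique)
    then show ?thesis
      by simp
  qed
  define b where "b = (v 1 - G 1) - (v 0 - G 0)"
  have v: "v = (\<lambda>x. G x + ((v 0 - G 0) + x * b))"
  proof
    fix x
    show "v x = G x + ((v 0 - G 0) + x * b)"
      using affine[of x] unfolding b_def by linarith
  qed
  show thesis
  proof (rule that)
    show "(v has_real_derivative G' x + b) (at x)" for x
      by (subst v) (auto intro!: derivative_eq_intros G)
    show "((\<lambda>x. G' x + b) has_real_derivative g x) (at x)" for x
      by (auto intro!: derivative_eq_intros G')
  qed
qed

section \<open>The localized maximum principle\<close>

text \<open>
  Coefficients of the delay equation. The smallness condition is stated pointwise so that it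
  passes directly to modified coefficients.
\<close>

locale delay_coefficients =
  fixes \<phi> q :: "real \<Rightarrow> real" and a :: real
  assumes continuous_delay: "continuous_on UNIV \<phi>"
    and continuous_potential: "continuous_on UNIV q"
    and delay_nonneg: "\<phi> x \<ge> 0"
    and potential_ge_1: "q x \<ge> 1"
    and a_ge_1: "a \<ge> 1"
    and slowly_varying: "t \<in> {x - 1..x + 1} \<Longrightarrow> q t \<le> a * q x"
    and delay_potential_le: "\<phi> x * q x \<le> 1 / (6 * sqrt a)"
begin

lemma delay_potential_bounds:
  shows "\<phi> x * q x \<le> 1 / 6" and "\<phi> x \<le> 1 / 6" and "a * (\<phi> x * q x)\<^sup>2 \<le> 1 / 36"
proof -
  have nonneg: "0 \<le> \<phi> x * q x"
    using delay_nonneg[of x] potential_ge_1[of x] by simp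
  have "1 / (6 * sqrt a) \<le> 1 / 6"
    using a_ge_1 by (simp add: field_simps)
  then show le: "\<phi> x * q x \<le> 1 / 6"
    using delay_potential_le[of x] by linarith
  have "\<phi> x * 1 \<le> \<phi> x * q x"
    using delay_nonneg[of x] potential_ge_1[of x] by (intro mult_left_mono)
  then show "\<phi> x \<le> 1 / 6"
    using le by linarith
  have "(\<phi> x * q x)\<^sup>2 \<le> (1 / (6 * sqrt a))\<^sup>2"
    using nonneg delay_potential_le by (intro power_mono)
  also have "\<dots> = 1 / (36 * a)"
    using a_ge_1 by (simp add: power_divide power_mult_distrib)
  finally show "a * (\<phi> x * q x)\<^sup>2 \<le> 1 / 36"
    using a_ge_1 by (simp add: field_simps)
qed

text \<open>
  At the maximum point of \<open>y\<close> minus the barrier, \<open>y''\<close> and \<open>y'\<close> are small. The delayed value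
  \<open>y (x - \<phi> x)\<close> differs from \<open>y x\<close> by at most \<open>\<phi> x * \<bar>y' x\<bar>\<close> plus \<open>(\<phi> x)\<^sup>2\<close> times a bound on
  \<open>\<bar>y''\<bar>\<close>, and the equation gives the bound \<open>a * q x * Y + F\<close> for the latter. Multiplied by \<open>q x\<close>
  the error contains \<open>a * (\<phi> x * q x)\<^sup>2 * Y \<le> Y / 36\<close>: this is where \<open>sqrt a\<close> in the
  smallness condition is used.

  Delays are at most \<open>1 / 6\<close>. The equation is needed one delay to the left of the maximum point
  and the values of \<open>y\<close> two delays to the left, whence the margins \<open>1\<close> and \<open>2\<close>.

  The parameter \<open>\<theta>\<close> joins the equation without delay and with constant potential (\<open>\<theta> = 0\<close>)
  to the delay equation (\<open>\<theta> = 1\<close>).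
\<close>

lemma maximum_principle_local:
  assumes y: "\<And>x. (y has_real_derivative y' x) (at x)"
    and y': "\<And>x. (y' has_real_derivative y'' x) (at x)"
    and eq: "\<And>x. x \<in> {c - r - 1..c + r} \<Longrightarrow> y'' x = (1 - \<theta>) * y x + \<theta> * q x * y (x - \<phi> x) - f x"
    and f: "\<And>x. x \<in> {c - r - 1..c + r} \<Longrightarrow> \<bar>f x\<bar> \<le> F"
    and Y: "\<And>x. x \<in> {c - r - 2..c + r} \<Longrightarrow> \<bar>y x\<bar> \<le> Y"
    and \<theta>: "0 \<le> \<theta>" "\<theta> \<le> 1" and r: "r > 0"
  obtains x where "x \<in> {c - r..c + r}" "y c \<le> y x"
    and "(1 - \<theta> + \<theta> * q x) * y x \<le> 4 * Y / r\<^sup>2 + Y / r + Y / 36 + 2 * F"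
proof -
  have "\<bar>y x\<bar> \<le> Y" if "x \<in> {c - r..c + r}" for x
    using that by (intro Y) auto
  then obtain x where x: "x \<in> {c - r..c + r}" "y c \<le> y x"
    and d1: "\<bar>y' x\<bar> \<le> 4 * Y / r" and d2: "y'' x \<le> 4 * Y / r\<^sup>2"
    using barrier_maximum_point[OF y y' r] by metis
  have F0: "F \<ge> 0" and Y0: "Y \<ge> 0"
    using f[of c] Y[of c] r by auto
  note \<phi> = delay_nonneg[of x] delay_potential_bounds[of x] and q1 = potential_ge_1[of x]
  define B where "B = a * q x * Y + F"
  have aq: "a * q x \<ge> 1"
    using mult_mono[of 1 a 1 "q x"] a_ge_1 q1 by simp
  have B0: "B \<ge> 0"
    using F0 Y0 aq by (auto simp: B_def)
  have y''_bound: "\<bar>y'' s\<bar> \<le> B" if s: "s \<in> {x - \<phi> x..x}" for s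
  proof -
    have s': "s \<in> {c - r - 1..c + r}" "s \<in> {x - 1..x + 1}"
      using s x(1) \<phi> by auto
    have "s - \<phi> s \<in> {c - r - 2..c + r}" "s \<in> {c - r - 2..c + r}"
      using s' delay_nonneg[of s] delay_potential_bounds[of s] by auto
    then have y_s: "\<bar>y s\<bar> \<le> Y" "\<bar>y (s - \<phi> s)\<bar> \<le> Y"
      using Y by auto
    have qs: "0 \<le> q s" "q s \<le> a * q x"
      using potential_ge_1[of s] slowly_varying[OF s'(2)] by auto
    have "\<bar>y'' s\<bar> \<le> \<bar>(1 - \<theta>) * y s\<bar> + \<bar>\<theta> * (q s * y (s - \<phi> s))\<bar> + \<bar>f s\<bar>"
      unfolding eq[OF s'(1)] by (simp add: mult.assoc)
    also have "\<dots> \<le> (1 - \<theta>) * (a * q x * Y) + \<theta> * (a * q x * Y) + F"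
    proof (intro add_mono f s')
      have "1 * Y \<le> a * q x * Y"
        using aq Y0 by (intro mult_right_mono)
      then show "\<bar>(1 - \<theta>) * y s\<bar> \<le> (1 - \<theta>) * (a * q x * Y)"
        unfolding abs_mult using y_s \<theta> by (intro mult_mono) auto
      have "\<bar>q s * y (s - \<phi> s)\<bar> \<le> a * q x * Y"
        unfolding abs_mult using qs y_s by (intro mult_mono) auto
      then show "\<bar>\<theta> * (q s * y (s - \<phi> s))\<bar> \<le> \<theta> * (a * q x * Y)"
        using \<theta> by (simp add: abs_mult mult_left_mono)
    qed
    also have "\<dots> = B"
      by (simp add: B_def algebra_simps)
    finally show ?thesis .
  qed
  have delayed: "\<bar>y x - y (x - \<phi> x)\<bar> \<le> \<phi> x * (4 * Y / r + \<phi> x * B)"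
  proof (cases "\<phi> x = 0")
    case False
    then have pos: "\<phi> x > 0"
      using \<phi> by simp
    obtain t where t: "x - \<phi> x < t" "t < x" "y x - y (x - \<phi> x) = (x - (x - \<phi> x)) * y' t"
      using MVT2[of "x - \<phi> x" x y y'] y pos by auto
    obtain s where s: "t < s" "s < x" "y' x - y' t = (x - t) * y'' s"
      using MVT2[of t x y' y''] y' t(2) by auto
    have "\<bar>y' x - y' t\<bar> \<le> \<phi> x * B"
      unfolding s(3) abs_mult using y''_bound[of s] s t \<phi> by (intro mult_mono) auto
    then have "\<bar>y' t\<bar> \<le> 4 * Y / r + \<phi> x * B"
      using d1 by linarith
    then show ?thesis
      unfolding t(3) abs_mult using pos by (simp add: mult_left_mono)
  qed simp
  have "q x * \<bar>y x - y (x - \<phi> x)\<bar> \<le> q x * (\<phi> x * (4 * Y / r + \<phi> x * B))"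
    using delayed q1 by (intro mult_left_mono) auto
  also have "\<dots> = (\<phi> x * q x) * (4 * Y / r) + a * (\<phi> x * q x)\<^sup>2 * Y + (\<phi> x * q x) * \<phi> x * F"
    by (simp add: B_def power2_eq_square algebra_simps)
  also have "\<dots> \<le> 1 / 6 * (4 * Y / r) + 1 / 36 * Y + 1 / 6 * (1 / 6) * F"
    using \<phi> q1 Y0 F0 r by (intro add_mono mult_mono) auto
  also have "\<dots> \<le> Y / r + Y / 36 + F"
    using Y0 F0 r by (simp add: field_simps)
  finally have error: "q x * \<bar>y x - y (x - \<phi> x)\<bar> \<le> Y / r + Y / 36 + F" .
  have "(1 - \<theta> + \<theta> * q x) * y x = y'' x + f x + \<theta> * (q x * (y x - y (x - \<phi> x)))"
    using eq[of x] x(1) by (simp add: algebra_simps)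
  also have "\<theta> * (q x * (y x - y (x - \<phi> x))) \<le> \<theta> * (q x * \<bar>y x - y (x - \<phi> x)\<bar>)"
    using \<theta> q1 by (intro mult_left_mono) auto
  also have "\<dots> \<le> 1 * (Y / r + Y / 36 + F)"
    using error \<theta> q1 by (intro mult_mono) auto
  finally have "(1 - \<theta> + \<theta> * q x) * y x \<le> 4 * Y / r\<^sup>2 + Y / r + Y / 36 + 2 * F"
    using d2 f[of x] x(1) by auto
  then show thesis
    using that x by blast
qed

lemma maximum_principle_local_abs:
  assumes y: "\<And>x. (y has_real_derivative y' x) (at x)"
    and y': "\<And>x. (y' has_real_derivative y'' x) (at x)"
    and eq: "\<And>x. x \<in> {c - r - 1..c + r} \<Longrightarrow> y'' x = (1 - \<theta>) * y x + \<theta> * q x * y (x - \<phi> x) - f x"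
    and f: "\<And>x. x \<in> {c - r - 1..c + r} \<Longrightarrow> \<bar>f x\<bar> \<le> F"
    and Y: "\<And>x. x \<in> {c - r - 2..c + r} \<Longrightarrow> \<bar>y x\<bar> \<le> Y"
    and \<theta>: "0 \<le> \<theta>" "\<theta> \<le> 1" and r: "r > 0"
  obtains x where "x \<in> {c - r..c + r}" "\<bar>y c\<bar> \<le> \<bar>y x\<bar>"
    and "(1 - \<theta> + \<theta> * q x) * \<bar>y x\<bar> \<le> 4 * Y / r\<^sup>2 + Y / r + Y / 36 + 2 * F"
proof (cases "y c \<ge> 0")
  case True
  obtain x where "x \<in> {c - r..c + r}" "y c \<le> y x"
    "(1 - \<theta> + \<theta> * q x) * y x \<le> 4 * Y / r\<^sup>2 + Y / r + Y / 36 + 2 * F"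
    using maximum_principle_local[OF y y' eq f Y \<theta> r] by blast
  then show thesis
    using that[of x] True by auto
next
  case False
  obtain x where "x \<in> {c - r..c + r}" "- y c \<le> - y x"
    "(1 - \<theta> + \<theta> * q x) * (- y x) \<le> 4 * Y / r\<^sup>2 + Y / r + Y / 36 + 2 * F"
    by (rule maximum_principle_local[of "\<lambda>x. - y x" "\<lambda>x. - y' x" "\<lambda>x. - y'' x" c r \<theta> "\<lambda>x. - f x" F Y])
      (use f Y \<theta> r in \<open>auto intro!: derivative_eq_intros y y' simp: eq algebra_simps\<close>)
  then show thesis
    using that[of x] False by auto
qed

text \<open>The value \<open>6\<close> of the radius makes the factor \<open>4 / 6\<^sup>2 + 1 / 6 + 1 / 36 = 11 / 36\<close> at most \<open>1 / 2\<close>.\<close>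

lemma contraction_estimate_local:
  assumes y: "\<And>x. (y has_real_derivative y' x) (at x)"
    and y': "\<And>x. (y' has_real_derivative y'' x) (at x)"
    and eq: "\<And>x. x \<in> {c - 8..c + 8} \<Longrightarrow> y'' x = (1 - \<theta>) * y x + \<theta> * q x * y (x - \<phi> x) - f x"
    and f: "\<And>x. x \<in> {c - 8..c + 8} \<Longrightarrow> \<bar>f x\<bar> \<le> F"
    and Y: "\<And>x. x \<in> {c - 8..c + 8} \<Longrightarrow> \<bar>y x\<bar> \<le> Y"
    and \<theta>: "0 \<le> \<theta>" "\<theta> \<le> 1"
  shows "\<bar>y c\<bar> \<le> Y / 2 + 2 * F"
proof -
  have Y0: "Y \<ge> 0"
    using Y[of c] by auto
  obtain x where x: "\<bar>y c\<bar> \<le> \<bar>y x\<bar>"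
    "(1 - \<theta> + \<theta> * q x) * \<bar>y x\<bar> \<le> 4 * Y / 6\<^sup>2 + Y / 6 + Y / 36 + 2 * F"
    by (rule maximum_principle_local_abs[of y y' y'' c 6 \<theta> f F Y]) (use y y' eq f Y \<theta> in auto)
  have "1 * \<bar>y x\<bar> \<le> (1 - \<theta> + \<theta> * q x) * \<bar>y x\<bar>"
    using mult_left_mono[OF potential_ge_1 \<theta>(1), of x] by (intro mult_right_mono) auto
  then show ?thesis
    using x Y0 by simp
qed

end

section \<open>Bounds for bounded solutions\<close>

text \<open>
  The equation \<open>- y'' + (1 - \<theta>) * y + \<theta> * q * y (x - \<phi> x) = f\<close>, solved for the second
  derivative. For \<open>\<theta> = 1\<close> and continuous data this is \<open>is_solution\<close>, since the right-hand
  side is then a continuous second derivative.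
\<close>

definition homotopy_solution ::
  "(real \<Rightarrow> real) \<Rightarrow> (real \<Rightarrow> real) \<Rightarrow> real \<Rightarrow> (real \<Rightarrow> real) \<Rightarrow> (real \<Rightarrow> real) \<Rightarrow> bool" where
  "homotopy_solution \<phi> q \<theta> f y \<longleftrightarrow>
     (\<exists>y'. (\<forall>x. (y has_real_derivative y' x) (at x)) \<and>
           (\<forall>x. (y' has_real_derivative ((1 - \<theta>) * y x + \<theta> * q x * y (x - \<phi> x) - f x)) (at x)))"

lemma homotopy_solution_diff:
  assumes "homotopy_solution \<phi> q \<theta> f y" and "homotopy_solution \<phi> q \<theta> g z"
  shows "homotopy_solution \<phi> q \<theta> (\<lambda>x. f x - g x) (\<lambda>x. y x - z x)"
proof -
  obtain y' z' where
    "\<And>x. (y has_real_derivative y' x) (at x)" "\<And>x. (z has_real_derivative z' x) (at x)"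
    "\<And>x. (y' has_real_derivative ((1 - \<theta>) * y x + \<theta> * q x * y (x - \<phi> x) - f x)) (at x)"
    "\<And>x. (z' has_real_derivative ((1 - \<theta>) * z x + \<theta> * q x * z (x - \<phi> x) - g x)) (at x)"
    using assms unfolding homotopy_solution_def by blast
  then show ?thesis
    unfolding homotopy_solution_def
    by (intro exI[of _ "\<lambda>x. y' x - z' x"])
      (auto intro!: derivative_eq_intros simp: algebra_simps)
qed

lemma is_solution_deriv2:
  assumes "is_solution \<phi> q f y"
  shows "deriv (deriv y) x = q x * y (x - \<phi> x) - f x"
  using assms by (simp add: is_solution_def algebra_simps)

lemma is_solution_imp_homotopy_solution:
  assumes "is_solution \<phi> q f y"
  shows "homotopy_solution \<phi> q 1 f y"
proof -
  have "(y has_real_derivative deriv y x) (at x)"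
    "(deriv y has_real_derivative deriv (deriv y) x) (at x)" for x
    using assms
    by (auto simp: is_solution_def twice_continuously_differentiable_def DERIV_deriv_iff_real_differentiable)
  then show ?thesis
    unfolding homotopy_solution_def using is_solution_deriv2[OF assms] by (auto intro!: exI[of _ "deriv y"])
qed

lemma homotopy_solution_imp_is_solution:
  assumes sol: "homotopy_solution \<phi> q 1 f y"
    and cont: "continuous_on UNIV \<phi>" "continuous_on UNIV q" "continuous_on UNIV f"
  shows "is_solution \<phi> q f y"
proof -
  obtain y' where y: "\<And>x. (y has_real_derivative y' x) (at x)"
    and y': "\<And>x. (y' has_real_derivative (q x * y (x - \<phi> x) - f x)) (at x)"
    using sol by (auto simp: homotopy_solution_def)
  have d: "deriv y = y'" "deriv y' = (\<lambda>x. q x * y (x - \<phi> x) - f x)"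
    using y y' by (auto intro!: ext DERIV_imp_deriv)
  have cont_y: "continuous_on UNIV y"
    using y by (meson DERIV_continuous continuous_at_imp_continuous_on)
  have "continuous_on UNIV (\<lambda>x. q x * y (x - \<phi> x) - f x)"
    by (intro continuous_intros cont continuous_on_compose2[OF cont_y]) auto
  then show ?thesis
    unfolding is_solution_def twice_continuously_differentiable_def d
    using y y' by (auto simp: real_differentiable_def)
qed

context delay_coefficients
begin

lemma homotopy_solution_bound:
  assumes sol: "homotopy_solution \<phi> q \<theta> f y" and \<theta>: "0 \<le> \<theta>" "\<theta> \<le> 1"
    and f: "\<And>x. \<bar>f x\<bar> \<le> F" and Y: "\<And>x. \<bar>y x\<bar> \<le> Y"
  shows "\<bar>y x\<bar> \<le> 4 * F"
proof -
  define S where "S = (SUP x. \<bar>y x\<bar>)"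
  have bdd: "bdd_above (range (\<lambda>x. \<bar>y x\<bar>))"
    using Y by (intro bdd_aboveI[of _ Y]) auto
  have y_le: "\<bar>y x\<bar> \<le> S" for x
    unfolding S_def by (intro cSUP_upper bdd) auto
  obtain y' where y: "\<And>x. (y has_real_derivative y' x) (at x)"
    and y': "\<And>x. (y' has_real_derivative ((1 - \<theta>) * y x + \<theta> * q x * y (x - \<phi> x) - f x)) (at x)"
    using sol by (auto simp: homotopy_solution_def)
  have "S \<le> S / 2 + 2 * F"
    unfolding S_def
  proof (rule cSUP_least)
    show "\<bar>y c\<bar> \<le> (SUP x. \<bar>y x\<bar>) / 2 + 2 * F" for c
      using contraction_estimate_local[OF y y' _ _ _ \<theta>] f y_le by (simp add: S_def)
  qed simp
  then show ?thesis
    using y_le[of x] by linarith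
qed

text \<open>
  With radius \<open>1\<close> the potential at the maximum point is comparable to the one at the centre,
  which turns the maximum principle into a bound on \<open>q * y\<close>.
\<close>

lemma potential_times_solution_bound:
  assumes sol: "homotopy_solution \<phi> q 1 f y"
    and f: "\<And>x. \<bar>f x\<bar> \<le> F" and Y: "\<And>x. \<bar>y x\<bar> \<le> Y"
  shows "q c * \<bar>y c\<bar> \<le> a * (6 * Y + 2 * F)"
proof -
  obtain y' where y: "\<And>x. (y has_real_derivative y' x) (at x)"
    and y': "\<And>x. (y' has_real_derivative (q x * y (x - \<phi> x) - f x)) (at x)"
    using sol by (auto simp: homotopy_solution_def)
  have Y0: "Y \<ge> 0"
    using Y[of c] by auto
  obtain x where x: "x \<in> {c - 1..c + 1}" "\<bar>y c\<bar> \<le> \<bar>y x\<bar>"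
    "q x * \<bar>y x\<bar> \<le> 4 * Y / 1\<^sup>2 + Y / 1 + Y / 36 + 2 * F"
    using maximum_principle_local_abs[OF y y', of c 1 1 f F Y] f Y by auto
  have "q c * \<bar>y c\<bar> \<le> (a * q x) * \<bar>y x\<bar>"
    using x(1,2) potential_ge_1[of c] slowly_varying[of c x] by (intro mult_mono) auto
  also have "\<dots> \<le> a * (6 * Y + 2 * F)"
    using x(3) Y0 a_ge_1 by (auto simp: mult.assoc intro!: mult_left_mono)
  finally show ?thesis .
qed

lemma norm_solution_le:
  assumes sol: "homotopy_solution \<phi> q \<theta> (apply_bcontfun f) (apply_bcontfun y)"
    and \<theta>: "0 \<le> \<theta>" "\<theta> \<le> 1"
  shows "norm y \<le> 4 * norm f"
  using homotopy_solution_bound[OF sol \<theta>, of "norm f" "norm y"]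
    norm_bounded[of f] norm_bounded[of y]
  by (intro norm_bound) auto

lemma norm_solution_diff_le:
  assumes "homotopy_solution \<phi> q \<theta> (apply_bcontfun f) (apply_bcontfun y)"
    and "homotopy_solution \<phi> q \<theta> (apply_bcontfun g) (apply_bcontfun z)"
    and "0 \<le> \<theta>" "\<theta> \<le> 1"
  shows "norm (y - z) \<le> 4 * norm (f - g)"
  using homotopy_solution_diff[OF assms(1,2)] assms(3,4)
  by (intro norm_solution_le) (simp_all add: minus_bcontfun.rep_eq)

text \<open>
  Passing from \<open>x\<close> to \<open>x - \<phi> x\<close> costs a second factor \<open>a\<close>, and \<open>26 = 6 * 4 + 2\<close> combines the bound on
  \<open>q * y\<close> with \<open>norm y \<le> 4 * norm f\<close>. The equation then bounds \<open>y''\<close>.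
\<close>

lemma separable: "separable_in_C \<phi> q"
  unfolding separable_in_C_def
proof (intro exI conjI allI impI)
  define c where "c = 26 * a\<^sup>2"
  have c: "c \<ge> 0"
    by (simp add: c_def)
  show "2 * c + 1 > 0"
    using c by linarith
  fix f y :: "real \<Rightarrow>\<^sub>C real"
  assume sol: "is_solution \<phi> q (apply_bcontfun f) (apply_bcontfun y)"
  note hom = is_solution_imp_homotopy_solution[OF sol]
  define p where "p = (\<lambda>x. q x * apply_bcontfun y (x - \<phi> x))"
  have f: "\<bar>apply_bcontfun f x\<bar> \<le> norm f" and y: "\<bar>apply_bcontfun y x\<bar> \<le> norm y" for x
    using norm_bounded[of f x] norm_bounded[of y x] by auto
  have p_le: "\<bar>p x\<bar> \<le> c * norm f" for x
  proof -
    let ?z = "x - \<phi> x"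
    have "?z \<in> {x - 1..x + 1}" "x \<in> {?z - 1..?z + 1}"
      using delay_nonneg[of x] delay_potential_bounds(2)[of x] by auto
    then have "\<bar>p x\<bar> \<le> (a * q ?z) * \<bar>apply_bcontfun y ?z\<bar>"
      unfolding p_def abs_mult using potential_ge_1[of x] slowly_varying by (intro mult_right_mono) auto
    also have "\<dots> \<le> a * (a * (6 * norm y + 2 * norm f))"
      using potential_times_solution_bound[OF hom f y, of ?z] a_ge_1
      by (simp add: mult.assoc)
    also have "\<dots> \<le> a * (a * (26 * norm f))"
      using norm_solution_le[OF hom] a_ge_1 by (intro mult_left_mono) auto
    finally show ?thesis
      by (simp add: c_def power2_eq_square)
  qed
  have "continuous_on UNIV p"
    unfolding p_def
    by (intro continuous_intros continuous_potential continuous_delay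
        continuous_on_compose2[OF continuous_on_apply_bcontfun[of UNIV y]]) auto
  then have p: "p \<in> bcontfun"
    using p_le by (intro bcontfun_normI) auto
  have d: "deriv (deriv (apply_bcontfun y)) = (\<lambda>x. p x - apply_bcontfun f x)"
    using is_solution_deriv2[OF sol] by (auto simp: p_def)
  have d_in: "(\<lambda>x. p x - apply_bcontfun f x) \<in> bcontfun"
    using p by (intro minus_cont apply_bcontfun)
  have "\<bar>p x - apply_bcontfun f x\<bar> \<le> (c + 1) * norm f" for x
    unfolding distrib_right using p_le[of x] f[of x] by linarith
  then have "norm (Bcontfun (\<lambda>x. p x - apply_bcontfun f x)) \<le> (c + 1) * norm f"
    using d_in by (intro norm_bound) (simp add: Bcontfun_inverse)
  moreover have "norm (Bcontfun p) \<le> c * norm f"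
    using p p_le by (intro norm_bound) (simp add: Bcontfun_inverse)
  ultimately show "norm (Bcontfun (deriv (deriv (apply_bcontfun y)))) +
      norm (Bcontfun (\<lambda>x. q x * apply_bcontfun y (x - \<phi> x))) \<le> (2 * c + 1) * norm f"
    unfolding d p_def[symmetric] by (simp add: algebra_simps)
  show "deriv (deriv (apply_bcontfun y)) \<in> bcontfun"
    unfolding d by (rule d_in)
  show "(\<lambda>x. q x * apply_bcontfun y (x - \<phi> x)) \<in> bcontfun"
    using p by (simp add: p_def)
qed

end

section \<open>Existence for bounded potentials\<close>

text \<open>
  With an antiderivative \<open>H\<close> of \<open>exp t * h t\<close> the functions \<open>H + F * exp\<close> and \<open>H - F * exp\<close> are
  monotone in opposite directions, so a single number \<open>L\<close> (the limit of \<open>H\<close> at \<open>-\<infinity>\<close>) separates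
  them. This replaces the improper integral \<open>\<integral> exp (t - x) * h t dt\<close> over \<open>t \<le> x\<close>.
\<close>

lemma bounded_first_order_solution:
  fixes h :: "real \<Rightarrow> real"
  assumes h: "continuous_on UNIV h" and F: "\<And>x. \<bar>h x\<bar> \<le> F"
  obtains z where "\<And>x. (z has_real_derivative (h x - z x)) (at x)" and "\<And>x. \<bar>z x\<bar> \<le> F"
proof -
  have "continuous_on UNIV (\<lambda>x. exp x * h x)"
    by (intro continuous_intros h)
  then obtain H where H: "\<And>x. (H has_real_derivative (exp x * h x)) (at x)"
    using antiderivative_exists by blast
  have incr: "H s + F * exp s \<le> H t + F * exp t" if "s \<le> t" for s t
  proof (rule DERIV_nonneg_imp_nondecreasing[OF that, of "\<lambda>x. H x + F * exp x"])
    fix x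
    have "((\<lambda>x. H x + F * exp x) has_real_derivative exp x * (h x + F)) (at x)"
      by (auto intro!: derivative_eq_intros H simp: algebra_simps)
    moreover have "0 \<le> exp x * (h x + F)"
      using F[of x] by auto
    ultimately show "\<exists>D. ((\<lambda>x. H x + F * exp x) has_real_derivative D) (at x) \<and> 0 \<le> D"
      by blast
  qed
  have decr: "H t - F * exp t \<le> H s - F * exp s" if "s \<le> t" for s t
  proof (rule DERIV_nonpos_imp_nonincreasing[OF that, of "\<lambda>x. H x - F * exp x"])
    fix x
    have "((\<lambda>x. H x - F * exp x) has_real_derivative exp x * (h x - F)) (at x)"
      by (auto intro!: derivative_eq_intros H simp: algebra_simps)
    moreover have "exp x * (h x - F) \<le> 0"
      using F[of x] by (auto simp: mult_le_0_iff)
    ultimately show "\<exists>D. ((\<lambda>x. H x - F * exp x) has_real_derivative D) (at x) \<and> D \<le> 0"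
      by blast
  qed
  have F0: "F \<ge> 0"
    using F[of 0] by linarith
  have below: "H s - F * exp s \<le> H t + F * exp t" for s t
  proof (cases "s \<le> t")
    case True
    have "0 \<le> F * exp s"
      using F0 by simp
    then show ?thesis
      using incr[OF True] by linarith
  next
    case False
    have "0 \<le> F * exp t"
      using F0 by simp
    then show ?thesis
      using decr[of t s] False by linarith
  qed
  define L where "L = (INF t. H t + F * exp t)"
  have L_le: "L \<le> H x + F * exp x" for x
    unfolding L_def using below[of 0] by (intro cINF_lower bdd_belowI[of _ "H 0 - F * exp 0"]) auto
  have L_ge: "H x - F * exp x \<le> L" for x
    unfolding L_def using below[of x] by (intro cINF_greatest) auto
  define z where "z = (\<lambda>x. exp (- x) * (H x - L))"
  show thesis
  proof (rule that)
    show "(z has_real_derivative (h x - z x)) (at x)" for x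
      unfolding z_def
      by (auto intro!: derivative_eq_intros H simp: algebra_simps exp_minus)
    show "\<bar>z x\<bar> \<le> F" for x
    proof -
      have "\<bar>H x - L\<bar> \<le> F * exp x"
        using L_le[of x] L_ge[of x] by linarith
      then have "\<bar>z x\<bar> \<le> exp (- x) * (F * exp x)"
        unfolding z_def abs_mult by (intro mult_mono) auto
      also have "\<dots> = F"
        by (simp add: exp_minus)
      finally show ?thesis .
    qed
  qed
qed

text \<open>
  The factorization \<open>1 - D\<^sup>2 = (1 + D) (1 - D)\<close> solves the start of the homotopy by two first-order
  problems; the second factor becomes the first one under the reflection \<open>x \<mapsto> - x\<close>.
\<close>

lemma homotopy_start:
  fixes f :: "real \<Rightarrow>\<^sub>C real"
  obtains y :: "real \<Rightarrow>\<^sub>C real" where "homotopy_solution \<phi> q 0 (apply_bcontfun f) (apply_bcontfun y)"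
proof -
  have "\<bar>apply_bcontfun f x\<bar> \<le> norm f" for x
    using norm_bounded[of f x] by simp
  then obtain z where z: "\<And>x. (z has_real_derivative (apply_bcontfun f x - z x)) (at x)"
    and z_le: "\<And>x. \<bar>z x\<bar> \<le> norm f"
    using bounded_first_order_solution[OF continuous_on_apply_bcontfun] by blast
  have "continuous_on UNIV z"
    using z by (meson DERIV_continuous continuous_at_imp_continuous_on)
  then have "continuous_on UNIV (\<lambda>x. z (- x))"
    by (rule continuous_on_compose2) (auto intro!: continuous_intros)
  then obtain w where w: "\<And>x. (w has_real_derivative (z (- x) - w x)) (at x)"
    and w_le: "\<And>x. \<bar>w x\<bar> \<le> norm f"
    using bounded_first_order_solution[of "\<lambda>x. z (- x)"] z_le by blast
  define y where "y = (\<lambda>x. w (- x))"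
  have y: "(y has_real_derivative (y x - z x)) (at x)" for x
    unfolding y_def using w[of "- x"] by (simp add: DERIV_mirror)
  have y': "((\<lambda>x. y x - z x) has_real_derivative (y x - apply_bcontfun f x)) (at x)" for x
    by (auto intro!: derivative_eq_intros y z)
  have "continuous_on UNIV y"
    using y by (meson DERIV_continuous continuous_at_imp_continuous_on)
  then have "y \<in> bcontfun"
    using w_le by (intro bcontfun_normI[of _ "norm f"]) (auto simp: y_def)
  moreover have "homotopy_solution \<phi> q 0 (apply_bcontfun f) y"
    unfolding homotopy_solution_def using y y' by (intro exI[of _ "\<lambda>x. y x - z x"]) auto
  ultimately show thesis
    using that[of "Bcontfun y"] by (simp add: Bcontfun_inverse)
qed

context delay_coefficients
begin

text \<open>
  The a priori bound \<open>4\<close> on the solution operator does not depend on \<open>\<theta>\<close>, so the admissible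
  step length does not either: the condition on \<open>d\<close> makes the fixed point map a contraction
  with factor \<open>1 / 2\<close>.
\<close>

lemma homotopy_step:
  assumes solvable: "\<And>g. \<exists>y. homotopy_solution \<phi> q \<theta> (apply_bcontfun g) (apply_bcontfun y)"
    and Q: "\<And>x. q x \<le> Q" and \<theta>: "0 \<le> \<theta>" "\<theta> \<le> 1"
    and d: "0 \<le> d" "8 * d * (1 + Q) \<le> 1"
  shows "\<exists>y. homotopy_solution \<phi> q (\<theta> + d) (apply_bcontfun f) (apply_bcontfun y)"
proof -
  obtain S where S: "\<And>g. homotopy_solution \<phi> q \<theta> (apply_bcontfun g) (apply_bcontfun (S g))"
    using solvable by metis
  define M where "M = (\<lambda>u::real \<Rightarrow>\<^sub>C real. Bcontfun (\<lambda>x. apply_bcontfun u x - q x * apply_bcontfun u (x - \<phi> x)))"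
  have M: "apply_bcontfun (M u) x = apply_bcontfun u x - q x * apply_bcontfun u (x - \<phi> x)" for u x
  proof -
    have "continuous_on UNIV (\<lambda>x. apply_bcontfun u x - q x * apply_bcontfun u (x - \<phi> x))"
      by (intro continuous_intros continuous_potential continuous_delay
          continuous_on_compose2[OF continuous_on_apply_bcontfun[of UNIV u]]) auto
    moreover have "\<bar>apply_bcontfun u x - q x * apply_bcontfun u (x - \<phi> x)\<bar> \<le> norm u + Q * norm u" for x
    proof -
      have "\<bar>q x * apply_bcontfun u (x - \<phi> x)\<bar> \<le> Q * norm u"
        unfolding abs_mult using Q[of x] potential_ge_1[of x] norm_bounded[of u "x - \<phi> x"]
        by (intro mult_mono) auto
      then show ?thesis
        using norm_bounded[of u x] by simp
    qed
    ultimately have "(\<lambda>x. apply_bcontfun u x - q x * apply_bcontfun u (x - \<phi> x)) \<in> bcontfun"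
      by (intro bcontfun_normI) auto
    then show ?thesis
      by (simp add: M_def Bcontfun_inverse)
  qed
  have M_diff: "norm (M u - M v) \<le> (1 + Q) * norm (u - v)" for u v
  proof (rule norm_bound)
    fix x
    let ?w = "apply_bcontfun (u - v)"
    have "\<bar>q x * ?w (x - \<phi> x)\<bar> \<le> Q * norm (u - v)"
      unfolding abs_mult using Q[of x] potential_ge_1[of x] norm_bounded[of "u - v" "x - \<phi> x"]
      by (intro mult_mono) auto
    moreover have "\<bar>?w x\<bar> \<le> norm (u - v)"
      using norm_bounded[of "u - v" x] by simp
    moreover have "apply_bcontfun (M u - M v) x = ?w x - q x * ?w (x - \<phi> x)"
      by (simp add: M algebra_simps)
    ultimately show "norm (apply_bcontfun (M u - M v) x) \<le> (1 + Q) * norm (u - v)"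
      by (simp add: distrib_right)
  qed
  define T where "T = (\<lambda>u. S (f + d *\<^sub>R M u))"
  have "dist (T u) (T v) \<le> 1 / 2 * dist u v" for u v
  proof -
    have "norm (T u - T v) \<le> 4 * norm ((f + d *\<^sub>R M u) - (f + d *\<^sub>R M v))"
      unfolding T_def using S S \<theta> by (rule norm_solution_diff_le)
    also have "(f + d *\<^sub>R M u) - (f + d *\<^sub>R M v) = d *\<^sub>R (M u - M v)"
      by (simp add: scaleR_diff_right)
    also have "4 * norm (d *\<^sub>R (M u - M v)) \<le> 4 * (d * ((1 + Q) * norm (u - v)))"
      using d M_diff by (auto intro!: mult_left_mono)
    also have "\<dots> = (8 * d * (1 + Q)) * (norm (u - v) / 2)"
      by simp
    also have "\<dots> \<le> 1 * (norm (u - v) / 2)"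
      using d by (intro mult_right_mono) auto
    finally show ?thesis
      by (simp add: dist_norm)
  qed
  then obtain y where "T y = y"
    using banach_fix_type[of "1 / 2" T] by auto
  then have y: "homotopy_solution \<phi> q \<theta> (apply_bcontfun (f + d *\<^sub>R M y)) (apply_bcontfun y)"
    using S[of "f + d *\<^sub>R M y"] by (simp add: T_def)
  have rhs: "(1 - \<theta>) * apply_bcontfun y x + \<theta> * q x * apply_bcontfun y (x - \<phi> x)
        - apply_bcontfun (f + d *\<^sub>R M y) x
      = (1 - (\<theta> + d)) * apply_bcontfun y x + (\<theta> + d) * q x * apply_bcontfun y (x - \<phi> x)
        - apply_bcontfun f x" for x
    by (simp add: M algebra_simps)
  show ?thesis
    using y unfolding homotopy_solution_def rhs by blast
qed

lemma solution_exists_if_potential_bounded: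
  assumes Q: "\<And>x. q x \<le> Q"
  shows "\<exists>y. homotopy_solution \<phi> q 1 (apply_bcontfun f) (apply_bcontfun y)"
proof -
  define N where "N = nat \<lceil>8 * (1 + Q)\<rceil>"
  have "Q \<ge> 1"
    using Q[of 0] potential_ge_1[of 0] by linarith
  then have N: "real N \<ge> 8 * (1 + Q)" "real N > 0"
    by (auto simp: N_def)
  have "\<exists>y. homotopy_solution \<phi> q (real k / real N) (apply_bcontfun g) (apply_bcontfun y)"
    if "k \<le> N" for k g
    using that
  proof (induction k arbitrary: g)
    case 0
    then show ?case
      using homotopy_start[of \<phi> q g] by auto
  next
    case (Suc k)
    have "\<exists>y. homotopy_solution \<phi> q (real k / real N + 1 / real N) (apply_bcontfun g) (apply_bcontfun y)"
      using Suc N by (intro homotopy_step[OF _ Q]) (auto simp: field_simps)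
    then show ?case
      by (simp add: add_divide_distrib add.commute)
  qed
  from this[of N f] show ?thesis
    using N by simp
qed

end

section \<open>Existence for general potentials\<close>

text \<open>
  Freezing the coefficients outside a bounded interval: the retraction onto the interval is
  1-Lipschitz, so all hypotheses survive with the same constant.
\<close>

definition clip :: "real \<Rightarrow> real \<Rightarrow> real" where
  "clip N x = max (- N) (min N x)"

context delay_coefficients
begin

lemma clipped_coefficients:
  shows "delay_coefficients (\<lambda>x. \<phi> (clip N x)) (\<lambda>x. q (clip N x)) a"
proof
  have clip: "continuous_on UNIV (clip N)"
    unfolding clip_def by (intro continuous_intros)
  show "continuous_on UNIV (\<lambda>x. \<phi> (clip N x))" "continuous_on UNIV (\<lambda>x. q (clip N x))"
    by (auto intro!: continuous_on_compose2[OF continuous_delay clip]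
        continuous_on_compose2[OF continuous_potential clip])
  fix x t :: real
  assume "t \<in> {x - 1..x + 1}"
  then have "clip N t \<in> {clip N x - 1..clip N x + 1}"
    by (auto simp: clip_def)
  then show "q (clip N t) \<le> a * q (clip N x)"
    by (rule slowly_varying)
qed (use delay_nonneg potential_ge_1 a_ge_1 delay_potential_le in auto)

lemma potential_bounded_on_interval:
  obtains Q where "\<And>x. x \<in> {-R..R} \<Longrightarrow> q x \<le> Q"
proof -
  have "bdd_above (q ` {-R..R})"
    by (intro bounded_imp_bdd_above compact_imp_bounded compact_continuous_image
        continuous_on_subset[OF continuous_potential]) auto
  then show thesis
    using that unfolding bdd_above_def by blast
qed

text \<open>Each application of the local estimate gains a factor \<open>1 / 2\<close> and costs a margin of length \<open>8\<close>.\<close>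

lemma homogeneous_solution_decay:
  assumes w: "\<And>x. (w has_real_derivative w' x) (at x)"
    and w': "\<And>x. (w' has_real_derivative w'' x) (at x)"
    and eq: "\<And>x. \<bar>x\<bar> \<le> N \<Longrightarrow> w'' x = q x * w (x - \<phi> x)"
    and W: "\<And>x. \<bar>w x\<bar> \<le> W"
    and c: "\<bar>c\<bar> + 8 * real k \<le> N"
  shows "\<bar>w c\<bar> \<le> W / 2 ^ k"
  using c
proof (induction k arbitrary: c)
  case 0
  then show ?case
    using W by simp
next
  case (Suc k)
  have "\<bar>w c\<bar> \<le> (W / 2 ^ k) / 2 + 2 * 0"
  proof (rule contraction_estimate_local[OF w w', of c 1 "\<lambda>_. 0"])
    fix x
    assume "x \<in> {c - 8..c + 8}"
    then have x: "\<bar>x\<bar> + 8 * real k \<le> N"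
      using Suc.prems by auto
    then show "\<bar>w x\<bar> \<le> W / 2 ^ k"
      by (rule Suc.IH)
    show "w'' x = (1 - 1) * w x + 1 * q x * w (x - \<phi> x) - 0"
      using x by (subst eq) auto
  qed auto
  then show ?case
    by simp
qed

text \<open>
  The solutions for clipped coefficients are uniformly bounded, and two of them differ on a
  large interval by a solution of the homogeneous equation; by the decay estimate they form a
  locally uniform Cauchy sequence.
\<close>

lemma solution_exists:
  "\<exists>y. homotopy_solution \<phi> q 1 (apply_bcontfun f) (apply_bcontfun y)"
proof -
  have "\<exists>y. homotopy_solution (\<lambda>x. \<phi> (clip (real n) x)) (\<lambda>x. q (clip (real n) x)) 1
      (apply_bcontfun f) (apply_bcontfun y)" for n
  proof -
    obtain Q where "\<And>x. x \<in> {- real n..real n} \<Longrightarrow> q x \<le> Q"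
      using potential_bounded_on_interval[of "real n"] by blast
    then have "q (clip (real n) x) \<le> Q" for x
      by (auto simp: clip_def)
    then show ?thesis
      by (rule delay_coefficients.solution_exists_if_potential_bounded[OF clipped_coefficients])
  qed
  then obtain b :: "nat \<Rightarrow> real \<Rightarrow>\<^sub>C real" where
    b: "\<And>n. homotopy_solution (\<lambda>x. \<phi> (clip (real n) x)) (\<lambda>x. q (clip (real n) x)) 1
      (apply_bcontfun f) (apply_bcontfun (b n))"
    by metis
  define y where "y = (\<lambda>n. apply_bcontfun (b n))"
  define y'' where "y'' = (\<lambda>n x. q (clip (real n) x) * y n (x - \<phi> (clip (real n) x)) - apply_bcontfun f x)"
  obtain y' where y: "\<And>n x. (y n has_real_derivative y' n x) (at x)"
    and y': "\<And>n x. (y' n has_real_derivative y'' n x) (at x)"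
    using b unfolding homotopy_solution_def y_def y''_def by (simp add: choice_iff) metis
  define F where "F = norm f"
  have y_le: "\<bar>y n x\<bar> \<le> 4 * F" for n x
  proof -
    have "norm (b n) \<le> 4 * F"
      unfolding F_def
      by (rule delay_coefficients.norm_solution_le[OF clipped_coefficients b]) auto
    then show ?thesis
      using norm_bounded[of "b n" x] by (simp add: y_def)
  qed
  have close: "\<bar>y n c - y m c\<bar> \<le> 8 * F / 2 ^ k"
    if "\<bar>c\<bar> + 8 * real k \<le> real n" "\<bar>c\<bar> + 8 * real k \<le> real m" for n m k c
  proof (rule homogeneous_solution_decay[where w = "\<lambda>x. y n x - y m x" and w' = "\<lambda>x. y' n x - y' m x"
        and w'' = "\<lambda>x. y'' n x - y'' m x" and N = "min (real n) (real m)"])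
    show "((\<lambda>x. y n x - y m x) has_real_derivative y' n x - y' m x) (at x)" for x
      by (intro DERIV_diff y)
    show "((\<lambda>x. y' n x - y' m x) has_real_derivative y'' n x - y'' m x) (at x)" for x
      by (intro DERIV_diff y')
    show "\<bar>y n x - y m x\<bar> \<le> 8 * F" for x
      using y_le[of n x] y_le[of m x] by linarith
    show "\<bar>c\<bar> + 8 * real k \<le> min (real n) (real m)"
      using that by simp
    show "y'' n x - y'' m x = q x * (y n (x - \<phi> x) - y m (x - \<phi> x))"
      if "\<bar>x\<bar> \<le> min (real n) (real m)" for x
    proof -
      have "clip (real n) x = x" "clip (real m) x = x"
        using that by (auto simp: clip_def)
      then show ?thesis
        by (simp add: y''_def algebra_simps)
    qed
  qed
  have small: "\<exists>k. 8 * F / 2 ^ k < e" if "e > 0" for e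
  proof -
    have "(\<lambda>k. 8 * F * (1 / 2) ^ k) \<longlonglongrightarrow> 8 * F * 0"
      by (intro tendsto_intros) auto
    then have "\<forall>\<^sub>F k in sequentially. 8 * F * (1 / 2) ^ k < e"
      using that by (intro order_tendstoD) auto
    then show ?thesis
      by (auto simp: eventually_sequentially power_divide)
  qed
  define v where "v = (\<lambda>c. lim (\<lambda>n. y n c))"
  have lim: "(\<lambda>n. y n c) \<longlonglongrightarrow> v c" for c
  proof -
    have "Cauchy (\<lambda>n. y n c)"
    proof (rule metric_CauchyI)
      fix e :: real
      assume "e > 0"
      then obtain k where k: "8 * F / 2 ^ k < e"
        using small by blast
      obtain N :: nat where N: "\<bar>c\<bar> + 8 * real k \<le> real N"
        using real_arch_simple by blast
      have "dist (y m c) (y n c) < e" if "m \<ge> N" "n \<ge> N" for m n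
        using close[of c k m n] N that k by (simp add: dist_real_def)
      then show "\<exists>N. \<forall>m\<ge>N. \<forall>n\<ge>N. dist (y m c) (y n c) < e"
        by blast
    qed
    then show ?thesis
      unfolding v_def by (simp add: Cauchy_convergent convergent_LIMSEQ_iff[symmetric])
  qed
  have near: "\<bar>y n c - v c\<bar> \<le> 8 * F / 2 ^ k" if n: "\<bar>c\<bar> + 8 * real k \<le> real n" for n k c
  proof (rule tendsto_upperbound)
    show "(\<lambda>m. \<bar>y n c - y m c\<bar>) \<longlonglongrightarrow> \<bar>y n c - v c\<bar>"
      by (intro tendsto_intros lim)
    show "\<forall>\<^sub>F m in sequentially. \<bar>y n c - y m c\<bar> \<le> 8 * F / 2 ^ k"
      using n close[OF n] by (auto intro!: eventually_sequentiallyI[of n])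
  qed simp
  have unif: "uniform_limit {-R..R} y v sequentially" for R
  proof (rule uniform_limitI)
    fix e :: real
    assume "e > 0"
    then obtain k where k: "8 * F / 2 ^ k < e"
      using small by blast
    obtain N :: nat where N: "R + 8 * real k \<le> real N"
      using real_arch_simple by blast
    have "dist (y n x) (v x) < e" if "n \<ge> N" "x \<in> {-R..R}" for n x
    proof -
      have "real N \<le> real n" "\<bar>x\<bar> \<le> R"
        using that by auto
      then have "\<bar>x\<bar> + 8 * real k \<le> real n"
        using N by linarith
      then show ?thesis
        using near[of x k n] k by (simp add: dist_real_def)
    qed
    then show "\<forall>\<^sub>F n in sequentially. \<forall>x\<in>{-R..R}. dist (y n x) (v x) < e"
      by (auto intro!: eventually_sequentiallyI[of N])
  qed
  have cont_v: "continuous_on UNIV v"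
  proof (rule continuous_at_imp_continuous_on, rule ballI)
    fix x
    have "continuous_on {-(\<bar>x\<bar> + 1)..\<bar>x\<bar> + 1} v"
      by (rule uniform_limit_theorem[OF _ unif]) (auto simp: y_def)
    then show "isCont v x"
      by (rule continuous_on_interior) auto
  qed
  have v_le: "\<bar>v x\<bar> \<le> 4 * F" for x
    using tendsto_rabs[OF lim[of x]] y_le by (intro tendsto_upperbound[of _ _ sequentially]) auto
  have unif'': "uniform_limit {-R..R} y'' (\<lambda>x. q x * v (x - \<phi> x) - apply_bcontfun f x) sequentially" for R
  proof (rule uniform_limitI)
    fix e :: real
    assume e: "e > 0"
    obtain Q where Q: "\<And>x. x \<in> {-R..R} \<Longrightarrow> q x \<le> Q"
      using potential_bounded_on_interval[of R] by blast
    define d where "d = e / (\<bar>Q\<bar> + 1)"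
    have d: "d > 0"
      using e by (simp add: d_def)
    have "\<forall>\<^sub>F n in sequentially. \<forall>x\<in>{-(R + 1)..R + 1}. dist (y n x) (v x) < d"
      using unif d by (rule uniform_limitD)
    moreover have "\<forall>\<^sub>F n in sequentially. R \<le> real n"
      using filterlim_real_sequentially by (simp add: filterlim_at_top)
    ultimately show "\<forall>\<^sub>F n in sequentially. \<forall>x\<in>{-R..R}.
        dist (y'' n x) (q x * v (x - \<phi> x) - apply_bcontfun f x) < e"
    proof eventually_elim
      case (elim n)
      show ?case
      proof
        fix x
        assume x: "x \<in> {-R..R}"
        then have "clip (real n) x = x"
          using elim(2) by (auto simp: clip_def)
        then have "dist (y'' n x) (q x * v (x - \<phi> x) - apply_bcontfun f x)
            = q x * dist (y n (x - \<phi> x)) (v (x - \<phi> x))"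
          using potential_ge_1[of x]
          by (simp add: y''_def dist_real_def abs_mult flip: right_diff_distrib)
        also have "\<dots> \<le> q x * d"
          using elim(1) x delay_nonneg[of x] delay_potential_bounds(2)[of x] potential_ge_1[of x]
          by (intro mult_left_mono less_imp_le) auto
        also have "\<dots> < (\<bar>Q\<bar> + 1) * d"
          using Q[OF x] d by (intro mult_strict_right_mono) auto
        also have "\<dots> = e"
          by (simp add: d_def)
        finally show "dist (y'' n x) (q x * v (x - \<phi> x) - apply_bcontfun f x) < e" .
      qed
    qed
  qed
  have "continuous_on UNIV (\<lambda>x. q x * v (x - \<phi> x) - apply_bcontfun f x)"
    by (intro continuous_intros continuous_potential continuous_delay continuous_on_apply_bcontfun
        continuous_on_compose2[OF cont_v]) auto
  then obtain v' where "\<And>x. (v has_real_derivative v' x) (at x)"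
    "\<And>x. (v' has_real_derivative (q x * v (x - \<phi> x) - apply_bcontfun f x)) (at x)"
    using second_derivative_of_limit[OF y y' lim unif''] by blast
  then have "homotopy_solution \<phi> q 1 (apply_bcontfun f) v"
    by (auto simp: homotopy_solution_def)
  moreover have "v \<in> bcontfun"
    using cont_v v_le by (intro bcontfun_normI) auto
  ultimately show ?thesis
    by (metis Bcontfun_inverse)
qed

end

section \<open>Correct solvability and separability\<close>

context delay_coefficients
begin

lemma correctly_solvable: "correctly_solvable \<phi> q"
  unfolding correctly_solvable_def
proof (intro conjI allI)
  fix f :: "real \<Rightarrow>\<^sub>C real"
  obtain y where "homotopy_solution \<phi> q 1 (apply_bcontfun f) (apply_bcontfun y)"
    using solution_exists by blast
  then have y: "is_solution \<phi> q (apply_bcontfun f) (apply_bcontfun y)"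
    by (intro homotopy_solution_imp_is_solution continuous_delay continuous_potential) auto
  show "\<exists>!y. is_solution \<phi> q (apply_bcontfun f) (apply_bcontfun y)"
  proof (rule ex1I)
    show "is_solution \<phi> q (apply_bcontfun f) (apply_bcontfun y)"
      by (rule y)
    fix z
    assume "is_solution \<phi> q (apply_bcontfun f) (apply_bcontfun z)"
    then have "norm (z - y) \<le> 4 * norm (f - f)"
      using y by (intro norm_solution_diff_le[of 1] is_solution_imp_homotopy_solution) auto
    then show "z = y"
      by simp
  qed
next
  show "\<exists>c>0. \<forall>(f :: real \<Rightarrow>\<^sub>C real) (y :: real \<Rightarrow>\<^sub>C real).
      is_solution \<phi> q (apply_bcontfun f) (apply_bcontfun y) \<longrightarrow> norm y \<le> c * norm f"
    using norm_solution_le[OF is_solution_imp_homotopy_solution] by (intro exI[of _ 4]) auto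
qed

end

theorem theorem1p1:
  fixes \<phi> q :: "real \<Rightarrow> real" and a :: real
  assumes "continuous_on UNIV \<phi>" and "continuous_on UNIV q"
    and "\<And>x. \<phi> x \<ge> 0" and "\<And>x. q x \<ge> 1"
    and "a \<ge> 1"
    and "\<And>x t. t \<in> {x - 1..x + 1} \<Longrightarrow> inverse a * q x \<le> q t \<and> q t \<le> a * q x"
    and "(SUP x. ereal (\<phi> x * q x)) \<le> ereal (1 / (6 * sqrt a))"
  shows "correctly_solvable \<phi> q \<and> separable_in_C \<phi> q"
proof -
  interpret delay_coefficients \<phi> q a
  proof
    show "\<phi> x * q x \<le> 1 / (6 * sqrt a)" for x
    proof -
      have "ereal (\<phi> x * q x) \<le> (SUP x. ereal (\<phi> x * q x))"
        by (rule SUP_upper) simp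
      also note assms(7)
      finally show ?thesis
        by simp
    qed
  qed (use assms in auto)
  show ?thesis
    using correctly_solvable separable by blast
qed

end
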